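(* Let $n\ge 1$. There is a bijection $\omega:\mathcal{T}_n\to\mathcal{A}_n$ such that $p(T)=\mathrm{Last}(\omega(T))$ for all $T\in\mathcal{T}_n$. In particular, for every $1\le k\le n$, $\omega$ restricts to a bijection from $\mathcal{T}_{n,k}=\{T\in\mathcal{T}_n: p(T)=k\}$ onto $\mathcal{A}_{n,k}=\{\sigma\in\mathcal{A}_n:\sigma_n=k\}$.
   Context: An increasing 1-2 tree on $[n]=\{1,\dots,n\}$ is a rooted tree with vertex set $[n]$ in which every vertex has at most two children and labels increase along every path going up from the root. Convention: if a vertex has a unique child, that child is its left child; if it has two children, the smaller one is the left child and the larger one the right child. $\mathcal{T}_n$ is the set of increasing 1-2 trees on $[n]$. The minimal path of $T$ is the sequence $v_1,\dots,v_\ell$ with $v_1$ the root, $v_{i+1}$ the left child of $v_i$, and $v_\ell$ a leaf; $p(T)=v_\ell$ is the minimal leaf. For a permutation $\sigma=\sigma_1\cdots\sigma_n$ of $[n]$, $\mathrm{Last}(\sigma)=\sigma_n$, and $\sigma_{[k]}$ denotes the subword of $\sigma$ consisting of the letters $1,\dots,k$ in the order they appear in $\sigma$. A double descent is a triple of consecutive letters $a>b>c$; a word ends with an ascent if its last two letters $x,y$ satisfy $x<y$. $\sigma$ is an André permutation if for every $1\le k\le n$, $\sigma_{[k]}$ has no double descents and ends with an ascent (the ascent condition being vacuous when the word has length 1). $\mathcal{A}_n$ is the set of André permutations of $[n]$. *)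

theory Defs
  imports "Graph_Theory.Pair_Digraph" "HOL-Combinatorics.Multiset_Permutations"
begin

section \<open>Increasing 1-2 trees\<close>

text \<open>
  A rooted tree is encoded by its vertex set together with its arcs from parent to child.
  The existing predicate \<open>tree\<close> of the graph library is not used: its notion of cycle is that of
  a directed cycle, so it also holds, for instance, for a transitively oriented triangle.
\<close>

definition rooted_tree :: "'a pair_pre_digraph \<Rightarrow> 'a \<Rightarrow> bool" where
  "rooted_tree T r \<longleftrightarrow>
     pair_wf_digraph T \<and>
     r \<in> pverts T \<and>
     (\<forall>u. (u, r) \<notin> parcs T) \<and>
     (\<forall>v \<in> pverts T - {r}. \<exists>!u. (u, v) \<in> parcs T) \<and>
     (\<forall>v \<in> pverts T. r \<rightarrow>\<^sup>*\<^bsub>with_proj T\<^esub> v)"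

definition tree_root :: "'a pair_pre_digraph \<Rightarrow> 'a" where
  "tree_root T = (THE r. rooted_tree T r)"

definition children :: "'a pair_pre_digraph \<Rightarrow> 'a \<Rightarrow> 'a set" where
  "children T v = {w. (v, w) \<in> parcs T}"

text \<open>
  The trees are not plane trees: left and right are determined by the labels, so they are no
  part of the data of a tree.
\<close>

definition incr_12_trees :: "nat \<Rightarrow> nat pair_pre_digraph set" where
  "incr_12_trees n =
     {T. pverts T = {1..n} \<and> (\<exists>r. rooted_tree T r) \<and>
         (\<forall>v \<in> pverts T. card (children T v) \<le> 2) \<and>
         (\<forall>(u, v) \<in> parcs T. u < v)}"

text \<open>
  Both clauses of the convention (a unique child is a left child; of two children the smaller
  one is the left child) say that the left child is the least child. The value is only
  meaningful if \<open>v\<close> has a child.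
\<close>

definition left_child :: "nat pair_pre_digraph \<Rightarrow> nat \<Rightarrow> nat" where
  "left_child T v = Min (children T v)"

definition minimal_path :: "nat pair_pre_digraph \<Rightarrow> nat list \<Rightarrow> bool" where
  "minimal_path T vs \<longleftrightarrow>
     vs \<noteq> [] \<and> hd vs = tree_root T \<and>
     successively (\<lambda>v w. children T v \<noteq> {} \<and> w = left_child T v) vs \<and>
     children T (last vs) = {}"

definition minimal_leaf :: "nat pair_pre_digraph \<Rightarrow> nat" where
  "minimal_leaf T = last (THE vs. minimal_path T vs)"

definition incr_12_trees_leaf :: "nat \<Rightarrow> nat \<Rightarrow> nat pair_pre_digraph set" where
  "incr_12_trees_leaf n k = {T \<in> incr_12_trees n. minimal_leaf T = k}"


text \<open>The definite descriptions above are justified on the sets where they are used.\<close>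

lemma rooted_tree_unique:
  assumes "rooted_tree T r" "rooted_tree T s"
  shows "r = s"
proof (rule ccontr)
  assume "r \<noteq> s"
  moreover have "r \<in> pverts T" "\<forall>u. (u, r) \<notin> parcs T"
    using assms(1) by (simp_all add: rooted_tree_def)
  moreover have "\<forall>v \<in> pverts T - {s}. \<exists>!u. (u, v) \<in> parcs T"
    using assms(2) by (simp add: rooted_tree_def)
  ultimately show False by blast
qed

lemma tree_root_eq: "rooted_tree T r \<Longrightarrow> tree_root T = r"
  unfolding tree_root_def by (rule the_equality) (auto intro: rooted_tree_unique)

lemma minimal_path_ex1:
  assumes T: "T \<in> incr_12_trees n"
  shows "\<exists>!vs. minimal_path T vs"
proof -
  let ?S = "\<lambda>v w. children T v \<noteq> {} \<and> w = left_child T v"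
  obtain r where r: "rooted_tree T r"
    using T unfolding incr_12_trees_def by blast
  have "pair_wf_digraph T" "pverts T = {1..n}"
    using T r by (simp_all add: incr_12_trees_def rooted_tree_def)
  then have wf: "children T v \<subseteq> {1..n}" for v
    unfolding children_def by (metis mem_Collect_eq pair_wf_digraph.in_arcsD2 subsetI)
  have incr: "v < w" if "w \<in> children T v" for v w
    using T that by (auto simp: incr_12_trees_def children_def)
  have lc: "left_child T v \<in> children T v" if "children T v \<noteq> {}" for v
    unfolding left_child_def using that wf[of v] finite_subset by (intro Min_in) auto
  have ex: "\<exists>vs. vs \<noteq> [] \<and> hd vs = v \<and> successively ?S vs \<and> children T (last vs) = {}" for v
  proof (induction "n - v" arbitrary: v rule: less_induct)
    case less
    show ?case
    proof (cases "children T v = {}")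
      case True
      then show ?thesis by (intro exI[of _ "[v]"]) simp
    next
      case False
      let ?w = "left_child T v"
      have "n - ?w < n - v"
      proof -
        have "v < ?w" using incr lc[OF False] by blast
        moreover have "?w \<le> n" using lc[OF False] wf[of v] by fastforce
        ultimately show ?thesis by linarith
      qed
      from less[OF this] obtain vs where vs: "vs \<noteq> []" "hd vs = ?w" "successively ?S vs"
          "children T (last vs) = {}" by blast
      then show ?thesis
        using False by (intro exI[of _ "v # vs"]) (simp add: successively_Cons)
    qed
  qed
  have uniq: "vs = ws"
    if "vs \<noteq> []" "ws \<noteq> []" "hd vs = hd ws" "successively ?S vs" "successively ?S ws"
       "children T (last vs) = {}" "children T (last ws) = {}" for vs ws
    using that
  proof (induction vs arbitrary: ws)
    case Nil
    then show ?case by simp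
  next
    case (Cons v vs)
    then obtain ws' where ws: "ws = v # ws'" by (cases ws) auto
    show ?case
    proof (cases "vs = [] \<or> ws' = []")
      case True
      then show ?thesis using Cons.prems ws by (auto simp: successively_Cons)
    next
      case False
      then show ?thesis
        using Cons.prems Cons.IH[of ws'] ws by (simp add: successively_Cons)
    qed
  qed
  show ?thesis
  proof (rule ex_ex1I)
    show "\<exists>vs. minimal_path T vs"
      using ex[of "tree_root T"] unfolding minimal_path_def .
    show "vs = ws" if "minimal_path T vs" "minimal_path T ws" for vs ws
      by (rule uniq) (use that in \<open>auto simp: minimal_path_def\<close>)
  qed
qed


section \<open>Andre permutations\<close>

text \<open>A permutation of \<open>{1..n}\<close> is written as the word (list) of its values.\<close>

definition subword_upto :: "nat list \<Rightarrow> nat \<Rightarrow> nat list" where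
  "subword_upto \<sigma> k = filter (\<lambda>x. x \<in> {1..k}) \<sigma>"

definition has_double_descent :: "nat list \<Rightarrow> bool" where
  "has_double_descent w \<longleftrightarrow> (\<exists>us a b c vs. w = us @ [a, b, c] @ vs \<and> a > b \<and> b > c)"

definition ends_with_ascent :: "nat list \<Rightarrow> bool" where
  "ends_with_ascent w \<longleftrightarrow> (\<exists>us x y. w = us @ [x, y] \<and> x < y)"

definition andre_perms :: "nat \<Rightarrow> nat list set" where
  "andre_perms n =
     {\<sigma> \<in> permutations_of_set {1..n}.
        \<forall>k \<in> {1..n}. \<not> has_double_descent (subword_upto \<sigma> k) \<and>
          (length (subword_upto \<sigma> k) \<noteq> 1 \<longrightarrow> ends_with_ascent (subword_upto \<sigma> k))}"

definition andre_perms_last :: "nat \<Rightarrow> nat \<Rightarrow> nat list set" where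
  "andre_perms_last n k = {\<sigma> \<in> andre_perms n. last \<sigma> = k}"

end

theory Submission
  imports Defs
begin

text \<open>
  Both families are generated by inserting the largest label, and the two insertion rules agree.
  In a tree with \<open>l\<close> leaves and minimal leaf \<open>k\<close>, the vertex \<open>n + 1\<close> may be hung below the minimal
  leaf (it becomes the minimal leaf), below one of the other \<open>l - 1\<close> leaves, or below one of the
  \<open>n + 1 - 2 * l\<close> vertices with exactly one child (creating a new leaf). In an Andre permutation
  with \<open>l - 1\<close> descents and last letter \<open>k\<close>, the letter \<open>n + 1\<close> may be placed at the end, in the
  middle of one of the \<open>l - 1\<close> descents, or in front of one of the \<open>n + 1 - 2 * l\<close> letters that are
  followed by an ascent but not preceded by a descent (creating a new descent). Hence the pairs
  (number of leaves, minimal leaf) and (number of descents + 1, last letter) are equidistributed.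
\<close>

section \<open>Equidistributed statistics\<close>

text \<open>For each value \<open>c\<close> the two fibres are finite and equally large, so some
  bijection \<open>h c\<close> matches them. The fibres partition \<open>X\<close> and
  \<open>Y\<close>, hence these maps glue to one bijection; this turns equidistribution into a
  bijection.\<close>

lemma ex_bij_betw_if_card_fibres_eq:
  assumes "finite X" "finite Y"
    and card: "\<And>c. card {x \<in> X. f x = c} = card {y \<in> Y. g y = c}"
  shows "\<exists>\<omega>. bij_betw \<omega> X Y \<and> (\<forall>x \<in> X. g (\<omega> x) = f x)"
proof -
  have "\<forall>c. \<exists>h. bij_betw h {x \<in> X. f x = c} {y \<in> Y. g y = c}"
    using assms by (auto intro!: finite_same_card_bij)
  then obtain h where h: "\<And>c. bij_betw (h c) {x \<in> X. f x = c} {y \<in> Y. g y = c}"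
    by metis
  define \<omega> where "\<omega> x = h (f x) x" for x
  have \<omega>: "\<omega> x \<in> Y" "g (\<omega> x) = f x" if "x \<in> X" for x
    using bij_betwE[OF h[of "f x"]] that by (auto simp: \<omega>_def)
  have "bij_betw \<omega> X Y"
  proof (rule bij_betw_imageI)
    show "inj_on \<omega> X"
    proof (rule inj_onI)
      fix x y assume xy: "x \<in> X" "y \<in> X" "\<omega> x = \<omega> y"
      then have "f x = f y" using \<omega>(2) by metis
      then show "x = y"
        using bij_betw_imp_inj_on[OF h[of "f x"]] xy by (auto simp: \<omega>_def inj_on_def)
    qed
    show "\<omega> ` X = Y"
    proof
      show "\<omega> ` X \<subseteq> Y" using \<omega>(1) by blast
      show "Y \<subseteq> \<omega> ` X"
      proof
        fix y assume "y \<in> Y"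
        then obtain x where "x \<in> X" "f x = g y" "y = h (g y) x"
          using bij_betw_imp_surj_on[OF h[of "g y"]] by blast
        then have "x \<in> X" "y = \<omega> x" by (simp_all add: \<omega>_def)
        then show "y \<in> \<omega> ` X" by blast
      qed
    qed
  qed
  with \<omega>(2) show ?thesis by blast
qed

text \<open>Every member of \<open>X'\<close> arises from exactly one pair of a smaller object and a
  slot, so a fibre of \<open>X'\<close> can be counted slot by slot over the smaller
  objects.\<close>

lemma card_fibre_insertion:
  assumes bij: "bij_betw (\<lambda>(x, s). ins x s) (Sigma X S) X'"
    and fin: "finite X" "\<And>x. x \<in> X \<Longrightarrow> finite (S x)"
  shows "card {x' \<in> X'. f x' = c} = (\<Sum>x\<in>X. card {s \<in> S x. f (ins x s) = c})"
proof -
  let ?A = "Sigma X (\<lambda>x. {s \<in> S x. f (ins x s) = c})"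
  have "X' = (\<lambda>(x, s). ins x s) ` Sigma X S"
    using bij by (simp add: bij_betw_def)
  then have "(\<lambda>(x, s). ins x s) ` ?A = {x' \<in> X'. f x' = c}" by auto
  then have "bij_betw (\<lambda>(x, s). ins x s) ?A {x' \<in> X'. f x' = c}"
    by (intro bij_betw_subset[OF bij]) auto
  then have "card {x' \<in> X'. f x' = c} = card ?A"
    by (rule bij_betw_same_card[symmetric])
  also have "\<dots> = (\<Sum>x\<in>X. card {s \<in> S x. f (ins x s) = c})"
    using fin by (intro card_SigmaI) auto
  finally show ?thesis .
qed

text \<open>The common transition rule: for an object of size \<open>n\<close> with statistic
  \<open>(l, k)\<close>, the number of slots that lead to statistic \<open>c\<close>. That it
  depends on the object through \<open>(l, k)\<close> alone is what lets both recursions run in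
  parallel.\<close>

definition succ_count :: "nat \<Rightarrow> nat \<times> nat \<Rightarrow> nat \<times> nat \<Rightarrow> nat" where
  "succ_count n = (\<lambda>(l, k) c. (if c = (l, Suc n) then 1 else 0) +
     (if c = (l, k) then l - 1 else 0) + (if c = (Suc l, k) then n + 1 - 2 * l else 0))"

text \<open>Shared bookkeeping for both families. For trees \<open>p\<close> is the minimal leaf,
  \<open>A\<close> the other leaves and \<open>B\<close> the vertices with one child; for words
  \<open>p\<close> is the end, \<open>A\<close> the middles of descents and \<open>B\<close> the
  remaining ascent positions. The three pieces are disjoint, so their contributions add up.\<close>

lemma card_insertions:
  assumes "finite A" "finite B" "p \<notin> A" "p \<notin> B" "A \<inter> B = {}"
    and "card A = l - 1" "card B = n + 1 - 2 * l"
    and "F p = (l, Suc n)" "\<And>s. s \<in> A \<Longrightarrow> F s = (l, k)" "\<And>s. s \<in> B \<Longrightarrow> F s = (Suc l, k)"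
  shows "card {s \<in> insert p (A \<union> B). F s = c} = succ_count n (l, k) c"
proof -
  let ?P = "if c = (l, Suc n) then {p} else {}"
    and ?A = "if c = (l, k) then A else {}" and ?B = "if c = (Suc l, k) then B else {}"
  have "{s \<in> A. F s = c} = ?A" "{s \<in> B. F s = c} = ?B" "{s \<in> {p}. F s = c} = ?P"
    using assms(8-10) by auto
  then have "{s \<in> insert p (A \<union> B). F s = c} = ?P \<union> (?A \<union> ?B)"
    by blast
  also have "card \<dots> = card ?P + card (?A \<union> ?B)"
    using assms(1-4) by (intro card_Un_disjoint) simp_all
  also have "card (?A \<union> ?B) = card ?A + card ?B"
    using assms(1,2,5) by (intro card_Un_disjoint) simp_all
  also have "card ?P + (card ?A + card ?B) = succ_count n (l, k) c"
    using assms(6,7) by (simp add: succ_count_def)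
  finally show ?thesis .
qed

section \<open>Insertion of the largest vertex\<close>

text \<open>Since labels increase, vertex 1 cannot have a parent and must be the root; conversely,
  if every other vertex has a smaller parent, strong induction on the label reaches it from 1. The
  global tree condition thus becomes a local condition on arcs, which is easy to check after adding
  or deleting an arc.\<close>

lemma incr_12_trees_iff:
  assumes "n \<ge> 1"
  shows "T \<in> incr_12_trees n \<longleftrightarrow> pverts T = {1..n} \<and> parcs T \<subseteq> {1..n} \<times> {1..n} \<and>
    (\<forall>(u, v) \<in> parcs T. u < v) \<and> (\<forall>v \<in> {2..n}. \<exists>!u. (u, v) \<in> parcs T) \<and>
    (\<forall>v \<in> {1..n}. card (children T v) \<le> 2)" (is "_ \<longleftrightarrow> ?R")
  and rooted_tree_1: "T \<in> incr_12_trees n \<Longrightarrow> rooted_tree T 1"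
proof -
  have root: "rooted_tree T 1" if T_in: "T \<in> incr_12_trees n"
  proof -
    obtain r where r: "rooted_tree T r" and T: "pverts T = {1..n}" "\<forall>(u, v) \<in> parcs T. u < v"
      using T_in unfolding incr_12_trees_def by blast
    interpret pair_wf_digraph T using r by (simp add: rooted_tree_def)
    have "r = 1"
    proof (rule ccontr)
      assume "r \<noteq> 1"
      then have "1 \<in> pverts T - {r}" using T(1) assms by simp
      then obtain u where "(u, 1) \<in> parcs T"
        using r unfolding rooted_tree_def by blast
      then show False using T in_arcsD1 by fastforce
    qed
    with r show ?thesis by simp
  qed
  then show "T \<in> incr_12_trees n \<Longrightarrow> rooted_tree T 1" .
  show "T \<in> incr_12_trees n \<longleftrightarrow> ?R"
  proof
    assume T: "T \<in> incr_12_trees n"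
    then have r: "rooted_tree T 1" by (rule root)
    interpret pair_wf_digraph T using r by (simp add: rooted_tree_def)
    have verts: "pverts T = {1..n}" using T by (simp add: incr_12_trees_def)
    then have "parcs T \<subseteq> {1..n} \<times> {1..n}"
      using in_arcsD1 in_arcsD2 by auto
    moreover have "\<exists>!u. (u, v) \<in> parcs T" if "v \<in> {2..n}" for v
    proof -
      have "v \<in> pverts T - {1}" using that verts by simp
      then show ?thesis using r unfolding rooted_tree_def by blast
    qed
    ultimately show ?R
      using T verts unfolding incr_12_trees_def by simp
  next
    assume R: ?R
    then have verts: "pverts T = {1..n}" and arcs: "parcs T \<subseteq> {1..n} \<times> {1..n}"
      and incr: "\<forall>(u, v) \<in> parcs T. u < v"
      and parent: "\<forall>v \<in> {2..n}. \<exists>!u. (u, v) \<in> parcs T"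
      by blast+
    have wf: "pair_wf_digraph T"
      using verts arcs by unfold_locales auto
    then interpret pair_wf_digraph T .
    have reach: "1 \<rightarrow>\<^sup>*\<^bsub>with_proj T\<^esub> v" if "v \<in> {1..n}" for v
      using that
    proof (induction v rule: less_induct)
      case (less v)
      show ?case
      proof (cases "v = 1")
        case True
        then show ?thesis using verts assms by (simp add: reachable_refl)
      next
        case False
        then have "v \<in> {2..n}" using less.prems by auto
        then obtain u where u: "(u, v) \<in> parcs T" using parent by blast
        then have "u < v" "u \<in> {1..n}" using arcs incr by auto
        then have "1 \<rightarrow>\<^sup>*\<^bsub>with_proj T\<^esub> u" by (rule less.IH)
        then show ?thesis using u by (auto intro: reachable_adj_trans)
      qed
    qed
    have "(u, 1) \<notin> parcs T" for u using arcs incr by fastforce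
    moreover have "\<forall>v\<in>{1..n} - {1}. \<exists>!u. (u, v) \<in> parcs T"
    proof
      fix v assume "v \<in> {1..n} - {1}"
      then have "v \<in> {2..n}" by auto
      then show "\<exists>!u. (u, v) \<in> parcs T" using parent by blast
    qed
    ultimately have "rooted_tree T 1"
      using verts reach wf assms unfolding rooted_tree_def by simp
    then show "T \<in> incr_12_trees n" using R unfolding incr_12_trees_def by auto
  qed
qed

section \<open>Hanging the largest vertex below another vertex\<close>

definition add_vertex :: "nat \<Rightarrow> nat pair_pre_digraph \<Rightarrow> nat \<Rightarrow> nat pair_pre_digraph" where
  "add_vertex n T v = \<lparr>pverts = {1..Suc n}, parcs = insert (v, Suc n) (parcs T)\<rparr>"

lemma children_add_vertex:
  "children (add_vertex n T v) u = (if u = v then insert (Suc n) (children T u) else children T u)"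
  by (auto simp: children_def add_vertex_def)

lemma children_subset:
  assumes "n \<ge> 1" "T \<in> incr_12_trees n"
  shows "children T v \<subseteq> {1..n}" "v \<notin> {1..n} \<Longrightarrow> children T v = {}"
  using assms by (auto simp: incr_12_trees_iff children_def)

lemma finite_children:
  assumes "n \<ge> 1" "T \<in> incr_12_trees n"
  shows "finite (children T v)"
  using children_subset(1)[OF assms] by (rule finite_subset) simp

lemma card_children_add_vertex:
  assumes "n \<ge> 1" "T \<in> incr_12_trees n"
  shows "card (children (add_vertex n T v) u) = card (children T u) + (if u = v then 1 else 0)"
proof -
  have "Suc n \<notin> children T u" using children_subset(1)[OF assms, of u] by auto
  then show ?thesis using finite_children[OF assms, of u] by (auto simp: children_add_vertex)
qed

lemma finite_incr_12_trees:
  assumes "n \<ge> 1"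
  shows "finite (incr_12_trees n)"
proof -
  have "incr_12_trees n \<subseteq> (\<lambda>E. \<lparr>pverts = {1..n}, parcs = E\<rparr>) ` Pow ({1..n} \<times> {1..n})"
  proof
    fix T assume "T \<in> incr_12_trees n"
    then have "T = \<lparr>pverts = {1..n}, parcs = parcs T\<rparr>" "parcs T \<in> Pow ({1..n} \<times> {1..n})"
      using assms by (auto simp: incr_12_trees_iff)
    then show "T \<in> (\<lambda>E. \<lparr>pverts = {1..n}, parcs = E\<rparr>) ` Pow ({1..n} \<times> {1..n})" by blast
  qed
  then show ?thesis by (rule finite_subset) simp
qed

lemma add_vertex_in_incr_12_trees:
  assumes "n \<ge> 1" "T \<in> incr_12_trees n" "v \<in> {1..n}" "card (children T v) \<le> 1"
  shows "add_vertex n T v \<in> incr_12_trees (Suc n)"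
proof -
  have T: "parcs T \<subseteq> {1..n} \<times> {1..n}" "\<forall>(u, v) \<in> parcs T. u < v"
      "\<forall>v \<in> {2..n}. \<exists>!u. (u, v) \<in> parcs T" "\<forall>v \<in> {1..n}. card (children T v) \<le> 2"
    using assms(1,2) by (auto simp: incr_12_trees_iff)
  have "\<exists>!u. (u, w) \<in> parcs (add_vertex n T v)" if "w \<in> {2..Suc n}" for w
  proof (cases "w = Suc n")
    case True
    then show ?thesis using T(1) by (auto simp: add_vertex_def)
  next
    case False
    then have "w \<in> {2..n}" using that by auto
    then show ?thesis using T(3) False by (simp add: add_vertex_def)
  qed
  moreover have "card (children (add_vertex n T v) w) \<le> 2" if "w \<in> {1..Suc n}" for w
  proof -
    have "card (children T w) \<le> 2"
      using T(4) children_subset(2)[OF assms(1,2), of w] by (cases "w \<in> {1..n}") auto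
    then show ?thesis using assms(4) by (simp add: card_children_add_vertex[OF assms(1,2)])
  qed
  ultimately show ?thesis
    using T(1,2) assms(3) by (subst incr_12_trees_iff) (auto simp: add_vertex_def)
qed

text \<open>Labels increase, so the largest vertex has no children and deleting it leaves a tree;
  its parent \<open>v\<close> had at most two children and loses one.\<close>

lemma incr_12_trees_Suc_cases:
  assumes "n \<ge> 1" "T' \<in> incr_12_trees (Suc n)"
  obtains T v where "T \<in> incr_12_trees n" "v \<in> {1..n}" "card (children T v) \<le> 1"
    "T' = add_vertex n T v"
proof -
  have T': "pverts T' = {1..Suc n}" "parcs T' \<subseteq> {1..Suc n} \<times> {1..Suc n}"
      "\<And>u v. (u, v) \<in> parcs T' \<Longrightarrow> u < v"
      "\<And>v. v \<in> {2..Suc n} \<Longrightarrow> \<exists>!u. (u, v) \<in> parcs T'"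
      "\<And>v. v \<in> {1..Suc n} \<Longrightarrow> card (children T' v) \<le> 2"
    using assms(2) by (auto simp: incr_12_trees_iff)
  obtain v where v: "(v, Suc n) \<in> parcs T'" "\<And>u. (u, Suc n) \<in> parcs T' \<Longrightarrow> u = v"
    using T'(4)[of "Suc n"] assms(1) by auto
  define T where "T = \<lparr>pverts = {1..n}, parcs = parcs T' - {(v, Suc n)}\<rparr>"
  \<comment> \<open>No remaining arc touches \<open>Suc n\<close>: its only incoming arc was
    removed, and an outgoing arc would need a larger target.\<close>
  have T_arcs: "u \<in> {1..n} \<and> w \<in> {1..n}" if "(u, w) \<in> parcs T' - {(v, Suc n)}" for u w
  proof -
    have "u < w" "u \<in> {1..Suc n}" "w \<in> {1..Suc n}" "w \<noteq> Suc n"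
      using T'(2) T'(3)[of u w] v(2)[of u] that by blast+
    then show ?thesis by simp
  qed
  have v': "v \<in> {1..n}" using T'(2) T'(3)[OF v(1)] v(1) by fastforce
  have "finite (parcs T')" using T'(2) by (rule finite_subset) simp
  then have fin: "finite (children T' w)" for w
    unfolding children_def by (rule finite_subset[rotated, OF finite_imageI[of _ snd]]) force
  have ch: "children T w = children T' w - (if w = v then {Suc n} else {})" for w
    by (auto simp: children_def T_def)
  have "T \<in> incr_12_trees n"
    unfolding incr_12_trees_iff[OF assms(1)]
  proof (intro conjI ballI)
    show "pverts T = {1..n}" by (simp add: T_def)
    show "parcs T \<subseteq> {1..n} \<times> {1..n}"
      using T_arcs unfolding T_def by (intro subrelI) simp
    show "case e of (u, v) \<Rightarrow> u < v" if "e \<in> parcs T" for e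
      using that T'(3) by (auto simp: T_def)
    show "\<exists>!u. (u, w) \<in> parcs T" if "w \<in> {2..n}" for w
      using that T'(4)[of w] by (simp add: T_def)
    show "card (children T w) \<le> 2" if "w \<in> {1..n}" for w
    proof -
      have "card (children T w) \<le> card (children T' w)"
        using fin[of w] by (intro card_mono) (auto simp: ch)
      then show ?thesis using that T'(5)[of w] by simp
    qed
  qed
  moreover have "card (children T v) \<le> 1"
  proof -
    have "Suc n \<in> children T' v" using v(1) by (simp add: children_def)
    then show ?thesis using T'(5)[of v] v' fin[of v] by (simp add: ch)
  qed
  moreover have "T' = add_vertex n T v"
    using T'(1) v(1) by (simp add: add_vertex_def T_def insert_absorb)
  ultimately show thesis using that v' by blast
qed

text \<open>The arc into \<open>Suc n\<close> reveals \<open>v\<close>, and removing it gives back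
  \<open>T\<close>; surjectivity is the deletion of the largest vertex.\<close>

lemma bij_betw_add_vertex:
  assumes "n \<ge> 1"
  shows "bij_betw (\<lambda>(T, v). add_vertex n T v)
    (SIGMA T:incr_12_trees n. {v \<in> {1..n}. card (children T v) \<le> 1}) (incr_12_trees (Suc n))"
proof (rule bij_betw_imageI)
  have inj: "T = U \<and> v = u"
    if T: "T \<in> incr_12_trees n" and U: "U \<in> incr_12_trees n"
      and eq: "add_vertex n T v = add_vertex n U u" for T U v u
  proof -
    have e: "insert (v, Suc n) (parcs T) = insert (u, Suc n) (parcs U)"
      using eq by (simp add: add_vertex_def)
    have *: "pverts T = {1..n}" "pverts U = {1..n}" "(x, Suc n) \<notin> parcs T" "(x, Suc n) \<notin> parcs U"
      for x using T U assms by (auto simp: incr_12_trees_iff)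
    then have "v = u" using e by blast
    then have "parcs T = parcs U" using e * by (metis insert_ident)
    with \<open>v = u\<close> * show ?thesis by simp
  qed
  then show "inj_on (\<lambda>(T, v). add_vertex n T v)
      (SIGMA T:incr_12_trees n. {v \<in> {1..n}. card (children T v) \<le> 1})"
    by (auto intro!: inj_onI dest: inj)
  show "(\<lambda>(T, v). add_vertex n T v) `
      (SIGMA T:incr_12_trees n. {v \<in> {1..n}. card (children T v) \<le> 1}) = incr_12_trees (Suc n)"
  proof (intro equalityI subsetI)
    fix T' assume "T' \<in> incr_12_trees (Suc n)"
    then obtain T v where "T \<in> incr_12_trees n" "v \<in> {1..n}" "card (children T v) \<le> 1"
      "T' = add_vertex n T v"
      by (rule incr_12_trees_Suc_cases[OF assms])
    then show "T' \<in> (\<lambda>(T, v). add_vertex n T v) `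
        (SIGMA T:incr_12_trees n. {v \<in> {1..n}. card (children T v) \<le> 1})"
      by (intro image_eqI[of _ _ "(T, v)"]) auto
  qed (use add_vertex_in_incr_12_trees[OF assms] in auto)
qed

section \<open>Leaves, one-child vertices and the minimal leaf\<close>

definition leaves :: "nat pair_pre_digraph \<Rightarrow> nat set" where
  "leaves T = {v \<in> pverts T. children T v = {}}"

lemma leaves_eq:
  assumes "n \<ge> 1" "T \<in> incr_12_trees n"
  shows "leaves T = {v \<in> {1..n}. card (children T v) = 0}"
  using assms finite_children[OF assms] by (simp add: leaves_def incr_12_trees_iff)

lemma leaves_add_vertex:
  assumes "n \<ge> 1" "T \<in> incr_12_trees n" "v \<in> {1..n}"
  shows "leaves (add_vertex n T v) = insert (Suc n) (leaves T - {v})"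
proof -
  have "pverts T = {1..n}" "children T (Suc n) = {}"
    using assms children_subset[OF assms(1,2)] by (auto simp: incr_12_trees_iff)
  moreover have "pverts (add_vertex n T v) = {1..Suc n}" by (simp add: add_vertex_def)
  ultimately show ?thesis
    using assms(3) by (auto simp: leaves_def children_add_vertex)
qed

text \<open>Count the arcs by their target and by their source.\<close>

lemma card_one_child:
  assumes "n \<ge> 1" "T \<in> incr_12_trees n"
  shows "card {v \<in> {1..n}. card (children T v) = 1} = n + 1 - 2 * card (leaves T)"
proof -
  let ?c = "\<lambda>v. card (children T v)"
  have T: "parcs T \<subseteq> {1..n} \<times> {1..n}" "\<forall>(u, v) \<in> parcs T. u < v"
      "\<forall>v \<in> {2..n}. \<exists>!u. (u, v) \<in> parcs T" "\<forall>v \<in> {1..n}. ?c v \<le> 2"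
    using assms by (auto simp: incr_12_trees_iff)
  have "(\<Sum>v\<in>{1..n}. ?c v) = card (SIGMA v:{1..n}. children T v)"
    using finite_children[OF assms] by simp
  also have "(SIGMA v:{1..n}. children T v) = parcs T"
    using T(1) by (auto simp: children_def)
  also have "card (parcs T) = card {2..n}"
  proof (rule bij_betw_same_card[of snd], rule bij_betw_imageI)
    have target: "snd e \<in> {2..n}" if "e \<in> parcs T" for e
      using that T(1,2) by fastforce
    show "inj_on snd (parcs T)"
      using T(3) target by (fastforce intro!: inj_onI)
    show "snd ` parcs T = {2..n}"
      using T(3) target by force
  qed
  finally have sum: "(\<Sum>v\<in>{1..n}. ?c v) = n - 1" by simp
  \<comment> \<open>With at most two children, the child count plus twice the indicator of a leaf
    plus the indicator of a single child is always 2; summing over all vertices relates the three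
    totals.\<close>
  have "(\<Sum>v\<in>{1..n}. ?c v + (2 * (if ?c v = 0 then 1 else 0) + (if ?c v = 1 then 1 else 0))) =
      (\<Sum>v\<in>{1..n}. 2)"
  proof (intro sum.cong refl)
    fix v assume "v \<in> {1..n}"
    then have "?c v \<le> 2" using T(4) by blast
    then have "?c v = 0 \<or> ?c v = 1 \<or> ?c v = 2" by linarith
    then show "?c v + (2 * (if ?c v = 0 then 1 else 0) + (if ?c v = 1 then 1 else 0)) = 2"
      by (elim disjE) simp_all
  qed
  moreover have "(\<Sum>v\<in>{1..n}. if ?c v = j then 1 else 0) = card {v \<in> {1..n}. ?c v = j}" for j
    by (subst sum.If_cases) (auto simp: Int_def)
  ultimately have "n - 1 + 2 * card (leaves T) + card {v \<in> {1..n}. ?c v = 1} = 2 * n"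
    using sum by (simp add: sum.distrib sum_distrib_left[symmetric] leaves_eq[OF assms])
  then show ?thesis using assms(1) by linarith
qed

lemma minimal_path_minimal_leaf:
  assumes "T \<in> incr_12_trees n"
  obtains vs where "minimal_path T vs" "minimal_leaf T = last vs"
  using theI'[OF minimal_path_ex1[OF assms]] unfolding minimal_leaf_def by blast

lemma minimal_leaf_eqI:
  assumes "T \<in> incr_12_trees n" "minimal_path T vs"
  shows "minimal_leaf T = last vs"
  using the1_equality[OF minimal_path_ex1[OF assms(1)] assms(2)] by (simp add: minimal_leaf_def)

lemma minimal_leaf_in_leaves:
  assumes n: "n \<ge> 1" and T: "T \<in> incr_12_trees n"
  shows "minimal_leaf T \<in> leaves T"
proof -
  obtain vs where vs: "minimal_path T vs" "minimal_leaf T = last vs"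
    using minimal_path_minimal_leaf[OF T] .
  let ?S = "\<lambda>v w. children T v \<noteq> {} \<and> w = left_child T v"
  have verts: "pverts T = {1..n}" using T n by (simp add: incr_12_trees_iff)
  \<comment> \<open>A minimal path ends in a childless vertex by definition; what needs induction is
    that it never leaves \<open>{1..n}\<close>. The starting point is kept general so that the
    induction can move along the path.\<close>
  have "last ws \<in> {1..n}" if "ws \<noteq> []" "hd ws \<in> {1..n}" "successively ?S ws" for ws
    using that
  proof (induction ws)
    case (Cons v ws)
    have "left_child T v \<in> {1..n}" if "children T v \<noteq> {}"
      using Min_in[OF finite_children[OF n T] that] children_subset(1)[OF n T, of v]
      by (auto simp: left_child_def)
    then show ?case using Cons by (cases "ws = []") (simp_all add: successively_Cons)
  qed simp
  moreover have "tree_root T = 1"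
    using rooted_tree_1[OF n T] by (rule tree_root_eq)
  ultimately have "last vs \<in> {1..n}"
    using vs(1) n by (auto simp: minimal_path_def)
  then show ?thesis using vs verts by (simp add: leaves_def minimal_path_def)
qed

text \<open>The new label exceeds all others, so it never displaces an existing left child: the old
  minimal path survives, and it is prolonged exactly when the new vertex hangs below its
  end.\<close>

lemma minimal_leaf_add_vertex:
  assumes n: "n \<ge> 1" and T: "T \<in> incr_12_trees n"
    and v: "v \<in> {1..n}" "card (children T v) \<le> 1"
  shows "minimal_leaf (add_vertex n T v) =
    (if v = minimal_leaf T then Suc n else minimal_leaf T)"
proof -
  let ?T = "add_vertex n T v"
  have T': "?T \<in> incr_12_trees (Suc n)"
    using add_vertex_in_incr_12_trees assms by blast
  have root: "tree_root T = 1" "tree_root ?T = 1"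
    using rooted_tree_1[OF n T] rooted_tree_1[OF _ T'] by (auto intro: tree_root_eq)
  obtain vs where vs: "minimal_path T vs" "minimal_leaf T = last vs"
    using minimal_path_minimal_leaf[OF T] .
  have left: "left_child ?T u = left_child T u" if "children T u \<noteq> {}" for u
  proof -
    have "Min (children T u) \<in> {1..n}"
      using Min_in[OF finite_children[OF n T] that] children_subset(1)[OF n T, of u] by blast
    then have "min (Suc n) (Min (children T u)) = Min (children T u)" by simp
    then show ?thesis
      using Min_insert[OF finite_children[OF n T] that, of "Suc n"]
      by (simp only: left_child_def children_add_vertex split: if_split) simp
  qed
  have "successively (\<lambda>v w. children T v \<noteq> {} \<and> w = left_child T v) vs"
    using vs(1) by (simp add: minimal_path_def)
  then have succ: "successively (\<lambda>v w. children ?T v \<noteq> {} \<and> w = left_child ?T v) vs"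
    by (rule successively_mono) (auto simp: left children_add_vertex)
  have "children T (Suc n) = {}" using children_subset(2)[OF n T, of "Suc n"] by simp
  \<comment> \<open>If \<open>v = last vs\<close>, then \<open>v\<close> was a leaf of
    \<open>T\<close>, so \<open>Suc n\<close> is its only and hence its left child, and
    \<open>Suc n\<close> itself is childless.\<close>
  then have "minimal_path ?T (if v = last vs then vs @ [Suc n] else vs)"
    using vs(1) succ root v(1)
    by (auto simp: minimal_path_def successively_append_iff children_add_vertex left_child_def)
  from minimal_leaf_eqI[OF T' this] show ?thesis by (simp add: vs(2))
qed

text \<open>The number of leaves is carried along because the minimal leaf alone does not fix the
  number of slots, so a recursion on it alone would not close.\<close>

definition tree_stat :: "nat pair_pre_digraph \<Rightarrow> nat \<times> nat" where
  "tree_stat T = (card (leaves T), minimal_leaf T)"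

text \<open>A vertex hung below a leaf replaces that leaf, so the leaf count stays; hung below a
  vertex with one child it adds a leaf. The minimal leaf changes only in the slot at the minimal
  leaf itself.\<close>

lemma card_add_vertex:
  assumes n: "n \<ge> 1" and T: "T \<in> incr_12_trees n"
  shows "card {v \<in> {v \<in> {1..n}. card (children T v) \<le> 1}. tree_stat (add_vertex n T v) = c} =
    succ_count n (tree_stat T) c"
proof -
  let ?A = "leaves T - {minimal_leaf T}" and ?B = "{v \<in> {1..n}. card (children T v) = 1}"
  have fin: "finite (leaves T)" by (simp add: leaves_eq[OF n T])
  have notin: "Suc n \<notin> leaves T" by (simp add: leaves_eq[OF n T])
  have pos: "card (leaves T) > 0"
    using minimal_leaf_in_leaves[OF n T] fin by (auto simp: card_gt_0_iff)
  have S: "{v \<in> {1..n}. card (children T v) \<le> 1} = insert (minimal_leaf T) (?A \<union> ?B)"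
    using minimal_leaf_in_leaves[OF n T] by (auto simp: leaves_eq[OF n T] le_Suc_eq)
  have stat: "tree_stat (add_vertex n T v) =
      (if v \<in> leaves T then card (leaves T) else Suc (card (leaves T)),
       if v = minimal_leaf T then Suc n else minimal_leaf T)"
    if "v \<in> {1..n}" "card (children T v) \<le> 1" for v
    using that fin notin pos
    by (auto simp: tree_stat_def minimal_leaf_add_vertex[OF n T] leaves_add_vertex[OF n T]
        card_Diff_singleton_if card_insert_if)
  show ?thesis
    unfolding S tree_stat_def[of T]
  proof (rule card_insertions)
    show "card ?A = card (leaves T) - 1"
      using minimal_leaf_in_leaves[OF n T] by simp
    show "card ?B = n + 1 - 2 * card (leaves T)" by (rule card_one_child[OF n T])
  qed (use fin minimal_leaf_in_leaves[OF n T] in \<open>auto simp: stat leaves_eq[OF n T]\<close>)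
qed

section \<open>Insertion of the largest letter\<close>

definition ascents :: "'a::linorder list \<Rightarrow> nat set" where
  "ascents w = {i. Suc i < length w \<and> w ! i < w ! Suc i}"

definition descents :: "'a::linorder list \<Rightarrow> nat set" where
  "descents w = {i. Suc i < length w \<and> w ! Suc i < w ! i}"

text \<open>For words without repetitions, this combines both conditions on a subword: the word has
  no double descents and does not end with a descent.\<close>

definition descents_followed_by_ascents :: "'a::linorder list \<Rightarrow> bool" where
  "descents_followed_by_ascents w \<longleftrightarrow> Suc ` descents w \<subseteq> ascents w"

lemma finite_ascents_descents [simp]: "finite (ascents w)" "finite (descents w)"
  unfolding ascents_def descents_def by (auto intro: finite_subset[of _ "{..<length w}"])

lemma card_ascents_descents:
  assumes "distinct w"
  shows "card (ascents w) + card (descents w) = length w - 1"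
proof -
  have "ascents w \<union> descents w = {..<length w - 1}"
  proof (intro equalityI subsetI)
    fix i assume "i \<in> {..<length w - 1}"
    then have "Suc i < length w" "w ! i \<noteq> w ! Suc i"
      using nth_eq_iff_index_eq[OF assms, of i "Suc i"] by auto
    then show "i \<in> ascents w \<union> descents w" by (auto simp: ascents_def descents_def)
  qed (auto simp: ascents_def descents_def)
  moreover have "ascents w \<inter> descents w = {}" by (auto simp: ascents_def descents_def)
  ultimately show ?thesis by (metis card_Un_disjoint card_lessThan finite_ascents_descents)
qed

lemma has_double_descent_iff:
  "has_double_descent w \<longleftrightarrow> (\<exists>i. i \<in> descents w \<and> Suc i \<in> descents w)"
proof
  assume "has_double_descent w"
  then obtain us a b c vs where w: "w = us @ [a, b, c] @ vs" "a > b" "b > c"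
    unfolding has_double_descent_def by blast
  then have "length us \<in> descents w" "Suc (length us) \<in> descents w"
    by (auto simp: descents_def nth_append)
  then show "\<exists>i. i \<in> descents w \<and> Suc i \<in> descents w" by blast
next
  assume "\<exists>i. i \<in> descents w \<and> Suc i \<in> descents w"
  then obtain i where i: "Suc (Suc i) < length w" "w ! i > w ! Suc i" "w ! Suc i > w ! Suc (Suc i)"
    by (auto simp: descents_def)
  then have "w = take i w @ [w ! i, w ! Suc i, w ! Suc (Suc i)] @ drop (Suc (Suc (Suc i))) w"
    by (simp add: Cons_nth_drop_Suc)
  with i show "has_double_descent w" unfolding has_double_descent_def by blast
qed

lemma ends_with_ascent_iff:
  "ends_with_ascent w \<longleftrightarrow> 2 \<le> length w \<and> length w - 2 \<in> ascents w"
proof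
  assume "ends_with_ascent w"
  then show "2 \<le> length w \<and> length w - 2 \<in> ascents w"
    by (auto simp: ends_with_ascent_def ascents_def nth_append)
next
  assume w: "2 \<le> length w \<and> length w - 2 \<in> ascents w"
  define i where "i = length w - 2"
  have i: "length w = Suc (Suc i)" using w unfolding i_def by linarith
  have "w = take i w @ [w ! i, w ! Suc i]"
    using i append_take_drop_id[of i w] by (simp add: Cons_nth_drop_Suc[symmetric])
  moreover have "w ! i < w ! Suc i" using w by (simp add: i_def ascents_def)
  ultimately show "ends_with_ascent w" unfolding ends_with_ascent_def by blast
qed

text \<open>In a word without repetitions every adjacent pair is an ascent or a descent. Hence a
  descent fails to be followed by an ascent only if another descent follows it or if it is the last
  pair.\<close>

lemma descents_followed_by_ascents_iff:
  assumes "distinct w" "w \<noteq> []"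
  shows "descents_followed_by_ascents w \<longleftrightarrow>
    \<not> has_double_descent w \<and> (length w \<noteq> 1 \<longrightarrow> ends_with_ascent w)"
proof -
  have asc_iff: "i \<in> ascents w \<longleftrightarrow> Suc i < length w \<and> i \<notin> descents w" for i
    using assms(1) nth_eq_iff_index_eq[OF assms(1), of i "Suc i"]
    by (auto simp: ascents_def descents_def)
  have len: "Suc i < length w" if "i \<in> descents w" for i
    using that by (simp add: descents_def)
  show ?thesis
  proof
    assume *: "descents_followed_by_ascents w"
    then have "Suc i \<in> ascents w" if "i \<in> descents w" for i
      using that by (auto simp: descents_followed_by_ascents_def)
    \<comment> \<open>If the last pair were a descent, the next position, at which no pair starts,
      would have to be an ascent. As \<open>w\<close> is nonempty and
      \<open>length w \<noteq> 1\<close>, the subtraction in \<open>length w - 2\<close> is not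
      truncated.\<close>
    moreover from this have "length w - 2 \<in> ascents w" if "length w \<noteq> 1"
      using that assms(2) asc_iff[of "length w - 2"] asc_iff[of "Suc (length w - 2)"]
      by (cases "length w - 2 \<in> descents w") (fastforce simp: neq_Nil_conv)+
    moreover have "2 \<le> length w" if "length w \<noteq> 1"
      using that assms(2) by (cases w) (auto simp: Suc_le_eq)
    ultimately show "\<not> has_double_descent w \<and> (length w \<noteq> 1 \<longrightarrow> ends_with_ascent w)"
      using asc_iff by (auto simp: has_double_descent_iff ends_with_ascent_iff)
  next
    assume *: "\<not> has_double_descent w \<and> (length w \<noteq> 1 \<longrightarrow> ends_with_ascent w)"
    show "descents_followed_by_ascents w"
      unfolding descents_followed_by_ascents_def
    proof (rule image_subsetI)
      fix i assume i: "i \<in> descents w"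
      have "length w - 2 \<in> ascents w" using * len[OF i] by (auto simp: ends_with_ascent_iff)
      then have "length w - 2 \<noteq> i" using i asc_iff by auto
      then show "Suc i \<in> ascents w"
        using * i len[OF i] asc_iff[of "Suc i"] by (auto simp: has_double_descent_iff)
    qed
  qed
qed

section \<open>Inserting a letter into a word\<close>

definition insert_at :: "'a \<Rightarrow> 'a list \<Rightarrow> nat \<Rightarrow> 'a list" where
  "insert_at x w i = take i w @ x # drop i w"

lemma length_insert_at [simp]: "length (insert_at x w i) = Suc (length w)"
  by (simp add: insert_at_def)

lemma set_insert_at [simp]: "set (insert_at x w i) = insert x (set w)"
  by (metis Un_insert_right append_take_drop_id insert_at_def list.simps(15) set_append)

lemma distinct_insert_at [simp]: "distinct (insert_at x w i) \<longleftrightarrow> distinct w \<and> x \<notin> set w"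
proof -
  have "mset (insert_at x w i) = mset (x # w)"
    by (metis add_mset_add_single append_take_drop_id insert_at_def mset.simps(2) mset_append
        union_mset_add_mset_right)
  then have "distinct (insert_at x w i) \<longleftrightarrow> distinct (x # w)" by (rule mset_eq_imp_distinct_iff)
  then show ?thesis by auto
qed

lemma filter_insert_at:
  "filter P (insert_at x w i) =
    (if P x then insert_at x (filter P w) (length (filter P (take i w))) else filter P w)"
proof -
  have "filter P w = filter P (take i w) @ filter P (drop i w)"
    by (metis append_take_drop_id filter_append)
  then show ?thesis by (simp add: insert_at_def)
qed

lemma nth_insert_at:
  assumes "i \<le> length w"
  shows "insert_at x w i ! j = (if j < i then w ! j else if j = i then x else w ! (j - 1))"
  using assms by (auto simp: insert_at_def nth_append min_def nth_Cons' intro!: arg_cong[of _ _ "nth w"])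

text \<open>The letter \<open>x\<close> occurs exactly once in each result, so both results split at
  the same place.\<close>

lemma insert_at_inject:
  assumes "insert_at x w i = insert_at x v j" "x \<notin> set w" "x \<notin> set v"
    and "i \<le> length w" "j \<le> length v"
  shows "w = v \<and> i = j"
proof -
  have "x \<notin> set (take i w)" "x \<notin> set (take j v)"
    using assms(2,3) by (auto dest: in_set_takeD)
  then have "take i w = take j v \<and> drop i w = drop j v"
    using assms(1-3) unfolding insert_at_def
    by (metis append_Cons_eq_iff in_set_dropD)
  then show ?thesis using assms(4,5)
    by (metis append_take_drop_id length_take min.absorb2)
qed

lemma in_set_insert_at_cases:
  assumes "x \<in> set w"
  obtains v i where "w = insert_at x v i" "i \<le> length v"
proof -
  obtain us vs where "w = us @ x # vs" using assms by (auto simp: in_set_conv_decomp)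
  then show thesis using that[of "us @ vs" "length us"] by (simp add: insert_at_def)
qed

context
  fixes x :: "'a::linorder" and w i
  assumes max: "\<forall>y \<in> set w. y < x" and i: "i \<le> length w"
begin

text \<open>Slot \<open>i\<close> lies in front of \<open>w ! i\<close>. The maximal letter starts a
  new descent unless it stands at the end; pairs before the slot keep their index, pairs after it
  move by one, and the pair \<open>j\<close> with \<open>Suc j = i\<close>, which the slot splits,
  disappears.\<close>

lemma descents_insert_at:
  "descents (insert_at x w i) =
    (if i = length w then {} else {i}) \<union>
    (\<lambda>j. if j < i then j else Suc j) ` {j \<in> descents w. Suc j \<noteq> i}"
proof -
  have lt: "w ! k < x" "\<not> x < w ! k" if "k < length w" for k
    using max that nth_mem[of k w] less_asym by blast+
  have "j \<in> descents (insert_at x w i) \<longleftrightarrow> j = i \<and> i < length w \<or>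
      j < i \<and> Suc j \<noteq> i \<and> j \<in> descents w \<or> j > i \<and> j - 1 \<in> descents w" for j
    using i lt by (cases j) (auto simp: descents_def nth_insert_at)
  moreover have "j \<in> (\<lambda>j. if j < i then j else Suc j) ` {j \<in> descents w. Suc j \<noteq> i} \<longleftrightarrow>
      j < i \<and> Suc j \<noteq> i \<and> j \<in> descents w \<or> j > i \<and> j - 1 \<in> descents w" for j
    by (cases j) (auto simp: image_iff)
  ultimately show ?thesis using i by (intro set_eqI) auto
qed

text \<open>The pair whose second letter is \<open>x\<close> is always an ascent, whatever the split
  pair was; the other pairs shift as for descents.\<close>

lemma ascents_insert_at:
  "j \<in> ascents (insert_at x w i) \<longleftrightarrow> Suc j = i \<or>
    j < i \<and> Suc j \<noteq> i \<and> j \<in> ascents w \<or> j > i \<and> j - 1 \<in> ascents w"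
proof -
  have lt: "w ! k < x" "\<not> x < w ! k" if "k < length w" for k
    using max that nth_mem[of k w] less_asym by blast+
  show ?thesis
    using i lt by (cases j) (auto simp: ascents_def nth_insert_at Suc_le_eq)
qed

text \<open>Away from the end, \<open>x\<close> begins a descent, so the pair after it, the old pair
  \<open>i\<close>, has to be an ascent. This suffices: a descent split by \<open>x\<close>
  disappears, and a split ascent leaves the ascent up to \<open>x\<close> in its place.\<close>

lemma descents_followed_by_ascents_insert_at:
  assumes "descents_followed_by_ascents w"
  shows "descents_followed_by_ascents (insert_at x w i) \<longleftrightarrow> i = length w \<or> i \<in> ascents w"
proof
  assume good: "descents_followed_by_ascents (insert_at x w i)"
  show "i = length w \<or> i \<in> ascents w"
  proof (cases "i = length w")
    case False
    then have "Suc i \<in> ascents (insert_at x w i)"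
      using good by (auto simp: descents_followed_by_ascents_def descents_insert_at)
    then show ?thesis by (simp add: ascents_insert_at)
  qed simp
next
  assume slot: "i = length w \<or> i \<in> ascents w"
  have asc: "Suc j \<in> ascents w" if "j \<in> descents w" for j
    using that assms by (auto simp: descents_followed_by_ascents_def)
  show "descents_followed_by_ascents (insert_at x w i)"
    unfolding descents_followed_by_ascents_def
  proof (rule image_subsetI)
    fix j assume "j \<in> descents (insert_at x w i)"
    then consider "j = i" "i \<noteq> length w" | "j < i" "Suc j \<noteq> i" "j \<in> descents w"
      | j' where "j = Suc j'" "i \<le> j'" "j' \<in> descents w"
      by (auto simp: descents_insert_at split: if_splits)
    then show "Suc j \<in> ascents (insert_at x w i)"
      using slot asc by cases (auto simp: ascents_insert_at)
  qed
qed

text \<open>Away from the end one descent is created at \<open>x\<close>, and one is lost exactly if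
  \<open>x\<close> splits a descent \<open>j\<close>, that is, if \<open>i = Suc j\<close>. At the
  end no descent is created or lost.\<close>

lemma card_descents_insert_at:
  "card (descents (insert_at x w i)) =
    (if i = length w \<or> i \<in> Suc ` descents w then card (descents w) else Suc (card (descents w)))"
proof -
  let ?D = "{j \<in> descents w. Suc j \<noteq> i}"
  define f where "f = (\<lambda>j. if j < i then j else Suc j)"
  have "inj_on f ?D" by (auto simp: f_def intro!: inj_onI split: if_splits)
  then have "card (f ` ?D) = card ?D" by (rule card_image)
  moreover have "i \<notin> f ` ?D" by (auto simp: f_def split: if_splits)
  moreover have "descents (insert_at x w i) = (if i = length w then {} else {i}) \<union> f ` ?D"
    by (simp only: descents_insert_at f_def)
  ultimately have card:
    "card (descents (insert_at x w i)) = (if i = length w then 0 else 1) + card ?D"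
    by (cases "i = length w") simp_all
  show ?thesis
  proof (cases "i \<in> Suc ` descents w")
    case True
    then obtain j where j: "i = Suc j" "j \<in> descents w" by blast
    then have "?D = descents w - {j}" by auto
    moreover have "i < length w" using j by (simp add: descents_def)
    moreover have "card (descents w) > 0" using j by (auto simp: card_gt_0_iff)
    ultimately show ?thesis using True card j by simp
  next
    case False
    then have "?D = descents w" by auto
    then show ?thesis using False card by simp
  qed
qed

end

section \<open>Andre permutations under insertion of the largest letter\<close>

lemma andre_perms_iff:
  "\<sigma> \<in> andre_perms n \<longleftrightarrow> set \<sigma> = {1..n} \<and> distinct \<sigma> \<and>
    (\<forall>k \<in> {1..n}. descents_followed_by_ascents (subword_upto \<sigma> k))"
proof (cases "set \<sigma> = {1..n} \<and> distinct \<sigma>")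
  case True
  have "distinct (subword_upto \<sigma> k)" "subword_upto \<sigma> k \<noteq> []" if "k \<in> {1..n}" for k
    using True that by (auto simp: subword_upto_def filter_empty_conv)
  then show ?thesis
    using True by (simp add: andre_perms_def permutations_of_set_def descents_followed_by_ascents_iff)
qed (auto simp: andre_perms_def permutations_of_set_def)

lemma andre_perms_D:
  assumes "\<sigma> \<in> andre_perms n"
  shows "set \<sigma> = {1..n}" "distinct \<sigma>" "length \<sigma> = n"
  using assms distinct_card[of \<sigma>] by (auto simp: andre_perms_iff)

lemma subword_upto_all: "set \<sigma> = {1..n} \<Longrightarrow> subword_upto \<sigma> n = \<sigma>"
  by (simp add: subword_upto_def)

lemma andre_perms_descents_followed_by_ascents:
  assumes "n \<ge> 1" "\<sigma> \<in> andre_perms n"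
  shows "descents_followed_by_ascents \<sigma>"
  using assms subword_upto_all[of \<sigma> n] by (force simp: andre_perms_iff)

lemma finite_andre_perms: "finite (andre_perms n)"
  unfolding andre_perms_def by simp

text \<open>For \<open>k \<le> n\<close> the letter \<open>Suc n\<close> is filtered out and the
  subword is that of \<open>\<sigma>\<close>, so the only new condition concerns the full word,
  where the slot criterion for a maximal letter applies.\<close>

lemma insert_at_in_andre_perms_iff:
  assumes "n \<ge> 1" "i \<le> length \<sigma>" "Suc n \<notin> set \<sigma>"
  shows "insert_at (Suc n) \<sigma> i \<in> andre_perms (Suc n) \<longleftrightarrow>
    \<sigma> \<in> andre_perms n \<and> (i = n \<or> i \<in> ascents \<sigma>)"
proof (cases "set \<sigma> = {1..n} \<and> distinct \<sigma>")
  case True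
  have sub: "subword_upto (insert_at (Suc n) \<sigma> i) k = subword_upto \<sigma> k" if "k \<le> n" for k
    using that by (simp add: subword_upto_def filter_insert_at)
  have all: "set (insert_at (Suc n) \<sigma> i) = {1..Suc n}"
    using True by (auto simp: le_Suc_eq)
  have "length \<sigma> = n" using True distinct_card[of \<sigma>] by simp
  moreover have "descents_followed_by_ascents (insert_at (Suc n) \<sigma> i) \<longleftrightarrow>
      i = length \<sigma> \<or> i \<in> ascents \<sigma>" if "\<sigma> \<in> andre_perms n"
    using True assms andre_perms_descents_followed_by_ascents[OF assms(1) that]
    by (intro descents_followed_by_ascents_insert_at) auto
  moreover have "(\<forall>k\<in>{1..Suc n}. descents_followed_by_ascents (subword_upto (insert_at (Suc n) \<sigma> i) k))
      \<longleftrightarrow> (\<forall>k\<in>{1..n}. descents_followed_by_ascents (subword_upto \<sigma> k)) \<and>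
        descents_followed_by_ascents (insert_at (Suc n) \<sigma> i)"
  proof -
    have "{1..Suc n} = insert (Suc n) {1..n}" by auto
    then show ?thesis using sub subword_upto_all[OF all] by auto
  qed
  then have "insert_at (Suc n) \<sigma> i \<in> andre_perms (Suc n) \<longleftrightarrow>
      \<sigma> \<in> andre_perms n \<and> descents_followed_by_ascents (insert_at (Suc n) \<sigma> i)"
    using True assms(3) all by (simp only: andre_perms_iff distinct_insert_at simp_thms)
  ultimately show ?thesis by blast
next
  case False
  \<comment> \<open>As \<open>Suc n\<close> does not occur in \<open>\<sigma>\<close>, a word
    \<open>\<sigma>\<close> that is not a permutation of \<open>{1..n}\<close> cannot become one of
    \<open>{1..Suc n}\<close>, so both sides fail.\<close>
  have "insert (Suc n) (set \<sigma>) \<noteq> {1..Suc n}" if "set \<sigma> \<noteq> {1..n}"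
  proof
    assume "insert (Suc n) (set \<sigma>) = {1..Suc n}"
    then have "set \<sigma> = {1..Suc n} - {Suc n}" using assms(3) by blast
    then show False using that by (simp add: atLeastAtMostSuc_conv)
  qed
  then have "\<not> (set (insert_at (Suc n) \<sigma> i) = {1..Suc n} \<and> distinct (insert_at (Suc n) \<sigma> i))"
    using False by auto
  then show ?thesis using False unfolding andre_perms_iff by blast
qed

text \<open>The position of the largest letter is the slot, and deleting that letter gives back
  \<open>\<sigma>\<close>. Since the slot criterion is an equivalence, the shorter word is again
  Andre and the slot is admissible.\<close>

lemma bij_betw_insert_at:
  assumes "n \<ge> 1"
  shows "bij_betw (\<lambda>(\<sigma>, i). insert_at (Suc n) \<sigma> i)
    (SIGMA \<sigma>:andre_perms n. insert n (ascents \<sigma>)) (andre_perms (Suc n))"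
proof (rule bij_betw_imageI)
  have *: "i \<le> length \<sigma>" "Suc n \<notin> set \<sigma>"
    if "\<sigma> \<in> andre_perms n" "i \<in> insert n (ascents \<sigma>)" for \<sigma> i
    using that andre_perms_D[OF that(1)] by (auto simp: ascents_def)
  have inj: "\<sigma> = \<tau> \<and> i = j"
    if "\<sigma> \<in> andre_perms n" "i \<in> insert n (ascents \<sigma>)" "\<tau> \<in> andre_perms n"
      "j \<in> insert n (ascents \<tau>)" "insert_at (Suc n) \<sigma> i = insert_at (Suc n) \<tau> j" for \<sigma> \<tau> i j
    by (rule insert_at_inject[OF that(5)]) (use * that(1-4) in blast)+
  show "inj_on (\<lambda>(\<sigma>, i). insert_at (Suc n) \<sigma> i)
      (SIGMA \<sigma>:andre_perms n. insert n (ascents \<sigma>))"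
  proof (rule inj_onI)
    fix p q
    assume "p \<in> (SIGMA \<sigma>:andre_perms n. insert n (ascents \<sigma>))"
      "q \<in> (SIGMA \<sigma>:andre_perms n. insert n (ascents \<sigma>))"
      "(case p of (\<sigma>, i) \<Rightarrow> insert_at (Suc n) \<sigma> i) = (case q of (\<sigma>, i) \<Rightarrow> insert_at (Suc n) \<sigma> i)"
    then show "p = q"
      using inj[of "fst p" "snd p" "fst q" "snd q"] by (cases p; cases q) simp
  qed
  show "(\<lambda>(\<sigma>, i). insert_at (Suc n) \<sigma> i) ` (SIGMA \<sigma>:andre_perms n. insert n (ascents \<sigma>)) =
      andre_perms (Suc n)"
  proof (intro equalityI subsetI)
    fix \<tau> assume "\<tau> \<in> (\<lambda>(\<sigma>, i). insert_at (Suc n) \<sigma> i) `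
      (SIGMA \<sigma>:andre_perms n. insert n (ascents \<sigma>))"
    then obtain \<sigma> i where slot: "\<sigma> \<in> andre_perms n" "i \<in> insert n (ascents \<sigma>)"
      and \<tau>: "\<tau> = insert_at (Suc n) \<sigma> i"
      by (elim imageE SigmaE) simp
    show "\<tau> \<in> andre_perms (Suc n)"
      using insert_at_in_andre_perms_iff[OF assms *[OF slot]] slot unfolding \<tau> by blast
  next
    fix \<tau> assume \<tau>: "\<tau> \<in> andre_perms (Suc n)"
    then have "Suc n \<in> set \<tau>" using andre_perms_D(1) by fastforce
    then obtain \<sigma> i where i: "\<tau> = insert_at (Suc n) \<sigma> i" "i \<le> length \<sigma>"
      by (rule in_set_insert_at_cases)
    moreover have "Suc n \<notin> set \<sigma>" using andre_perms_D(2)[OF \<tau>] i by simp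
    ultimately have "(\<sigma>, i) \<in> (SIGMA \<sigma>:andre_perms n. insert n (ascents \<sigma>))"
      using \<tau> insert_at_in_andre_perms_iff[OF assms, of i \<sigma>] by blast
    then show "\<tau> \<in> (\<lambda>(\<sigma>, i). insert_at (Suc n) \<sigma> i) `
        (SIGMA \<sigma>:andre_perms n. insert n (ascents \<sigma>))"
      using i(1) by (intro image_eqI[of _ _ "(\<sigma>, i)"]) simp_all
  qed
qed

text \<open>The offset by one aligns descents with leaves: a single letter has no descent, whereas a
  single vertex is already one leaf.\<close>

definition word_stat :: "nat list \<Rightarrow> nat \<times> nat" where
  "word_stat w = (Suc (card (descents w)), last w)"

lemma last_insert_at:
  assumes "i \<le> length w" "w \<noteq> []"
  shows "last (insert_at x w i) = (if i = length w then x else last w)"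
  using assms by (simp add: insert_at_def last_append)

text \<open>Each descent of an Andre permutation is followed by an ascent, so the middles of
  descents, \<open>?A\<close>, are admissible slots. They preserve the number of descents, while the
  other ascent positions, \<open>?B\<close>, raise it by one.\<close>

lemma card_insert_at:
  assumes n: "n \<ge> 1" and \<sigma>: "\<sigma> \<in> andre_perms n"
  shows "card {i \<in> insert n (ascents \<sigma>). word_stat (insert_at (Suc n) \<sigma> i) = c} =
    succ_count n (word_stat \<sigma>) c"
proof -
  let ?A = "Suc ` descents \<sigma>" and ?B = "ascents \<sigma> - Suc ` descents \<sigma>"
  note D = andre_perms_D[OF \<sigma>]
  have sub: "?A \<subseteq> ascents \<sigma>"
    using andre_perms_descents_followed_by_ascents[OF n \<sigma>]
    by (simp add: descents_followed_by_ascents_def)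
  have notin: "n \<notin> ascents \<sigma>" using D by (auto simp: ascents_def)
  have S: "insert n (ascents \<sigma>) = insert n (?A \<union> ?B)" using sub by blast
  have ne: "\<sigma> \<noteq> []" using D n by auto
  have stat: "word_stat (insert_at (Suc n) \<sigma> i) =
      (if i = n \<or> i \<in> ?A then Suc (card (descents \<sigma>)) else Suc (Suc (card (descents \<sigma>))),
       if i = n then Suc n else last \<sigma>)" if "i \<le> n" for i
    using that D card_descents_insert_at[of \<sigma> "Suc n" i]
    by (auto simp: word_stat_def last_insert_at[OF _ ne])
  have le: "i \<le> n" if "i \<in> ascents \<sigma>" for i using that D by (auto simp: ascents_def)
  show ?thesis
    unfolding S word_stat_def[of \<sigma>]
  proof (rule card_insertions)
    show "card ?A = Suc (card (descents \<sigma>)) - 1" by (simp add: card_image)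
    have "card ?B = card (ascents \<sigma>) - card (descents \<sigma>)"
      using sub by (simp add: card_Diff_subset card_image)
    \<comment> \<open>Ascents and descents together number \<open>n - 1\<close>; with
      \<open>d\<close> descents, removing \<open>d\<close> twice leaves
      \<open>n - 1 - 2 * d\<close>, which is \<open>n + 1 - 2 * Suc d\<close>.\<close>
    then show "card ?B = n + 1 - 2 * Suc (card (descents \<sigma>))"
      using card_ascents_descents[OF D(2)] D(3) by simp
  qed (use sub notin le stat in auto)
qed

section \<open>The bijection\<close>

text \<open>Induction on \<open>n\<close>: both counts at size \<open>n + 1\<close> are sums of the
  same \<open>succ_count\<close> over the objects of size \<open>n\<close>, and these sums agree
  because the statistics are equidistributed at size \<open>n\<close>.\<close>

lemma card_tree_stat_eq_card_word_stat:
  assumes "n \<ge> 1"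
  shows "card {T \<in> incr_12_trees n. tree_stat T = c} = card {\<sigma> \<in> andre_perms n. word_stat \<sigma> = c}"
  using assms
proof (induction n arbitrary: c rule: nat_induct_at_least)
  case base
  \<comment> \<open>For \<open>n = 1\<close> each family has a single member, and both statistics
    equal \<open>(1, 1)\<close>.\<close>
  define T :: "nat pair_pre_digraph" where "T = \<lparr>pverts = {1}, parcs = {}\<rparr>"
  have ch: "children T v = {}" for v by (simp add: children_def T_def)
  have T: "T \<in> incr_12_trees 1"
    by (subst incr_12_trees_iff) (auto simp: ch, auto simp: T_def)
  have "U = T" if "U \<in> incr_12_trees 1" for U
  proof -
    have "pverts U = {1}" "parcs U = {}" using that by (auto simp: incr_12_trees_iff)
    then show ?thesis by (simp add: T_def)
  qed
  with T have trees: "incr_12_trees 1 = {T}" by blast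
  have "minimal_path T [1]"
    using tree_root_eq[OF rooted_tree_1[OF _ T]] by (simp add: minimal_path_def ch)
  then have "minimal_leaf T = 1" using minimal_leaf_eqI[OF T] by force
  moreover have "leaves T = {1}" using ch by (auto simp: leaves_def T_def)
  ultimately have "tree_stat T = (1, 1)" by (simp add: tree_stat_def)
  moreover have words: "andre_perms 1 = {[1]}"
  proof -
    have "\<sigma> = [1]" if \<sigma>: "\<sigma> \<in> andre_perms 1" for \<sigma>
    proof -
      obtain a where "\<sigma> = [a]"
        using andre_perms_D(3)[OF \<sigma>] by (metis One_nat_def length_0_conv length_Suc_conv)
      then show ?thesis using andre_perms_D(1)[OF \<sigma>] by simp
    qed
    moreover have "[1] \<in> andre_perms 1"
      by (simp add: andre_perms_iff subword_upto_def descents_followed_by_ascents_def descents_def)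
    ultimately show ?thesis by blast
  qed
  moreover have "word_stat [1] = (1, 1)" by (simp add: word_stat_def descents_def)
  ultimately show ?case unfolding trees words by (cases "c = (1, 1)") (simp_all cong: conj_cong)
next
  case (Suc n)
  let ?X = "incr_12_trees n" and ?Y = "andre_perms n"
  \<comment> \<open>The induction hypothesis, taken for all values of the statistic at once, becomes
    a statistic-preserving bijection, along which the sum over trees is reindexed to a sum over
    words.\<close>
  obtain \<omega> where \<omega>: "bij_betw \<omega> ?X ?Y" "\<forall>T \<in> ?X. word_stat (\<omega> T) = tree_stat T"
    using ex_bij_betw_if_card_fibres_eq[OF finite_incr_12_trees finite_andre_perms Suc.IH] Suc.hyps
    by blast
  have "card {T \<in> incr_12_trees (Suc n). tree_stat T = c} =
      (\<Sum>T\<in>?X. card {v \<in> {v \<in> {1..n}. card (children T v) \<le> 1}. tree_stat (add_vertex n T v) = c})"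
    by (rule card_fibre_insertion[OF bij_betw_add_vertex[OF Suc.hyps]
          finite_incr_12_trees[OF Suc.hyps]]) simp
  also have "\<dots> = (\<Sum>T\<in>?X. succ_count n (tree_stat T) c)"
    by (rule sum.cong[OF refl card_add_vertex[OF Suc.hyps]])
  also have "\<dots> = (\<Sum>T\<in>?X. succ_count n (word_stat (\<omega> T)) c)"
    using \<omega>(2) by simp
  also have "\<dots> = (\<Sum>\<sigma>\<in>?Y. succ_count n (word_stat \<sigma>) c)"
    by (rule sum.reindex_bij_betw[OF \<omega>(1)])
  also have "\<dots> =
      (\<Sum>\<sigma>\<in>?Y. card {i \<in> insert n (ascents \<sigma>). word_stat (insert_at (Suc n) \<sigma> i) = c})"
    by (rule sum.cong[OF refl card_insert_at[OF Suc.hyps, symmetric]])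
  also have "\<dots> = card {\<sigma> \<in> andre_perms (Suc n). word_stat \<sigma> = c}"
    by (rule card_fibre_insertion[OF bij_betw_insert_at[OF Suc.hyps] finite_andre_perms,
          symmetric]) simp
  finally show ?case .
qed

theorem theorem2p5:
  fixes n :: nat
  assumes "n \<ge> 1"
  shows "\<exists>\<omega>. bij_betw \<omega> (incr_12_trees n) (andre_perms n) \<and>
             (\<forall>T \<in> incr_12_trees n. minimal_leaf T = last (\<omega> T)) \<and>
             (\<forall>k \<in> {1..n}. bij_betw \<omega> (incr_12_trees_leaf n k) (andre_perms_last n k))"
proof -
  obtain \<omega> where \<omega>: "bij_betw \<omega> (incr_12_trees n) (andre_perms n)"
      "\<forall>T \<in> incr_12_trees n. word_stat (\<omega> T) = tree_stat T"
    using ex_bij_betw_if_card_fibres_eq[OF finite_incr_12_trees finite_andre_perms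
        card_tree_stat_eq_card_word_stat] assms by blast
  have last: "minimal_leaf T = last (\<omega> T)" if "T \<in> incr_12_trees n" for T
    using \<omega>(2) that by (auto simp: word_stat_def tree_stat_def)
  \<comment> \<open>Since \<open>\<omega>\<close> maps onto all Andre permutations and turns the
    minimal leaf into the last letter, it carries the fibre over \<open>k\<close> onto the fibre
    over \<open>k\<close>.\<close>
  have "bij_betw \<omega> (incr_12_trees_leaf n k) (andre_perms_last n k)" for k
  proof (rule bij_betw_subset[OF \<omega>(1)])
    show "incr_12_trees_leaf n k \<subseteq> incr_12_trees n" by (auto simp: incr_12_trees_leaf_def)
    have "andre_perms n = \<omega> ` incr_12_trees n" using \<omega>(1) by (simp add: bij_betw_def)
    then show "\<omega> ` incr_12_trees_leaf n k = andre_perms_last n k"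
      using last by (auto simp: incr_12_trees_leaf_def andre_perms_last_def)
  qed
  with \<omega>(1) last show ?thesis by blast
qed

end
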